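(* (i) For any infinite abelian group $G$ and any integer $h\geq 2$, $E_G(h)\leq h-1$; that is, every $A\subset G$ with $hA\sim G$ has at most $h-1$ exceptional elements. (ii) There is an infinite abelian group $G$ such that $E_G(h)=h-1$ for every integer $h\geq 2$. (iii) For each integer $h\geq 2$ there is an infinite abelian group $G$ (depending on $h$) such that $E_G(h)=0$.
   Context: For $A\subset G$ and a positive integer $h$, $hA$ is the set of sums of $h$ not necessarily distinct elements of $A$; $A\sim B$ means the symmetric difference of $A$ and $B$ is finite. $A\subset G$ is a basis (of $G$) if $kA\sim G$ for some positive integer $k$. If $A$ is a basis, an element $a\in A$ is exceptional if $A\setminus\{a\}$ is not a basis (of any order), and regular otherwise; $A^*$ denotes the set of regular elements of $A$. For an infinite abelian group $G$, $E_G(h)=\sup\{|A\setminus A^*| : A\subset G,\ hA\sim G\}$. *)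

theory Defs
  imports "HOL-Algebra.Algebra" "HOL-Library.Extended_Nat"
begin

text \<open>
  Abelian groups are commutative groups of HOL-Algebra, hence written multiplicatively:
  a sum of \<open>h\<close> elements is a \<^const>\<open>finprod\<close> over \<open>{..<h}\<close>.
\<close>

definition sumset :: "('a, 'b) monoid_scheme \<Rightarrow> nat \<Rightarrow> 'a set \<Rightarrow> 'a set" where
  "sumset G h A = {finprod G f {..<h} | f. f \<in> {..<h} \<rightarrow> A}"

definition almost_eq :: "'a set \<Rightarrow> 'a set \<Rightarrow> bool" (infix \<open>\<sim>\<^sub>f\<close> 50) where
  "A \<sim>\<^sub>f B \<longleftrightarrow> finite (sym_diff A B)"

definition is_basis :: "('a, 'b) monoid_scheme \<Rightarrow> 'a set \<Rightarrow> bool" where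
  "is_basis G A \<longleftrightarrow> A \<subseteq> carrier G \<and> (\<exists>k>0. sumset G k A \<sim>\<^sub>f carrier G)"

definition regular_elements :: "('a, 'b) monoid_scheme \<Rightarrow> 'a set \<Rightarrow> 'a set" where
  "regular_elements G A = {a \<in> A. is_basis G (A - {a})}"

definition exceptional_elements :: "('a, 'b) monoid_scheme \<Rightarrow> 'a set \<Rightarrow> 'a set" where
  "exceptional_elements G A = A - regular_elements G A"

text \<open>Cardinality with value \<open>\<infinity>\<close>, instead of the \<open>0\<close> of \<^const>\<open>card\<close>, on infinite sets.\<close>

definition ecard :: "'a set \<Rightarrow> enat" where
  "ecard A = (if finite A then enat (card A) else \<infinity>)"

definition E :: "('a, 'b) monoid_scheme \<Rightarrow> nat \<Rightarrow> enat" where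
  "E G h = Sup {ecard (exceptional_elements G A) | A. A \<subseteq> carrier G \<and> sumset G h A \<sim>\<^sub>f carrier G}"

end

theory Submission
  imports Defs
begin

text \<open>
  Let \<open>A\<close> be a basis, \<open>a \<in> A\<close> and \<open>B = A - {a}\<close>, and let \<open>D\<close> be the group of differences of two
  elements of the same \<open>mB\<close>. If \<open>a - b = u - v \<in> D\<close> with \<open>b \<in> B\<close> and \<open>u, v \<in> mB\<close>, then
  \<open>a + v = b + u \<in> (m+1)B\<close>, whence \<open>hA + hv \<subseteq> h(m+1)B\<close> and \<open>B\<close> is a basis. So if \<open>a\<close> is exceptional,
  then \<open>a - b \<notin> D\<close>, whereas \<open>B\<close> lies in the single coset \<open>b + D\<close>.

  (i) If \<open>T\<close> consisted of \<open>h\<close> exceptional elements, then for distinct \<open>b, c \<in> A - T\<close> the element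
  \<open>\<Sum>T + c - b\<close> is congruent to \<open>\<Sum>T\<close> modulo each of the groups \<open>D\<close>. A representation of it as a sum
  of \<open>h\<close> elements of \<open>A\<close> must therefore use every element of \<open>T\<close>, so that it equals \<open>\<Sum>T\<close>, a
  contradiction. (ii) In an infinite power of \<open>\<int>/2\<close> take a subgroup of codimension \<open>h - 1\<close> together
  with representatives of a basis of the quotient. (iii) An exceptional element yields an element of
  order between \<open>2\<close> and \<open>h + 1\<close> in a quotient of \<open>G\<close>, which is impossible in an infinite power of
  \<open>\<int>/((h + 1)! + 1)\<close>.
\<close>

section \<open>Sumsets\<close>

text \<open>For \<open>B\<close> inside an abelian group this is the subgroup generated by the
  differences of two elements of \<open>B\<close>. The explicit form keeps \<open>u\<close> and
  \<open>v\<close>, sums of the same length, at hand.\<close>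

definition difference_group :: "('a, 'b) monoid_scheme \<Rightarrow> 'a set \<Rightarrow> 'a set" where
  "difference_group G B = {u \<otimes>\<^bsub>G\<^esub> inv\<^bsub>G\<^esub> v | u v m. u \<in> sumset G m B \<and> v \<in> sumset G m B}"

context comm_group
begin

lemma sumset_0: "sumset G 0 A = {\<one>}"
  by (auto simp: sumset_def)

text \<open>Replaces the choice functions by a recursion, on which the later inductions
  rest.\<close>

lemma sumset_Suc:
  assumes "A \<subseteq> carrier G"
  shows "sumset G (Suc n) A = {x \<otimes> y | x y. x \<in> sumset G n A \<and> y \<in> A}"
proof (intro subset_antisym subsetI)
  fix z assume "z \<in> sumset G (Suc n) A"
  then obtain f where f: "z = finprod G f {..<Suc n}" "f \<in> {..<Suc n} \<rightarrow> A"
    by (auto simp: sumset_def)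
  have fc: "f n \<in> carrier G" "f \<in> {..<n} \<rightarrow> carrier G"
    using f(2) assms by (auto simp: Pi_iff)
  then have "z = f n \<otimes> finprod G f {..<n}"
    by (simp add: f(1) lessThan_Suc)
  also have "\<dots> = finprod G f {..<n} \<otimes> f n"
    using fc by (simp add: m_comm)
  finally show "z \<in> {x \<otimes> y | x y. x \<in> sumset G n A \<and> y \<in> A}"
    using f(2) by (fastforce simp: sumset_def)
next
  fix z assume "z \<in> {x \<otimes> y | x y. x \<in> sumset G n A \<and> y \<in> A}"
  then obtain f y where f: "z = finprod G f {..<n} \<otimes> y" "f \<in> {..<n} \<rightarrow> A" "y \<in> A"
    by (auto simp: sumset_def)
  define g where "g = f(n := y)"
  have gA: "g \<in> {..<Suc n} \<rightarrow> A"
    using f by (auto simp: g_def Pi_iff)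
  have fc: "f \<in> {..<n} \<rightarrow> carrier G" "y \<in> carrier G"
    using f assms by auto
  have "finprod G g {..<n} = finprod G f {..<n}"
    by (rule finprod_cong') (use fc in \<open>auto simp: g_def\<close>)
  moreover have "g \<in> {..<n} \<rightarrow> carrier G" "g n = y"
    using fc by (auto simp: g_def)
  ultimately have "finprod G g {..<Suc n} = y \<otimes> finprod G f {..<n}"
    using fc by (simp add: lessThan_Suc)
  then have "z = finprod G g {..<Suc n}"
    using f(1) fc by (simp add: m_comm)
  with gA show "z \<in> sumset G (Suc n) A"
    by (auto simp: sumset_def)
qed

lemma sumset_closed: "A \<subseteq> carrier G \<Longrightarrow> sumset G n A \<subseteq> carrier G"
  by (induction n) (auto simp: sumset_0 sumset_Suc)

lemma sumset_1: "A \<subseteq> carrier G \<Longrightarrow> sumset G (Suc 0) A = A"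
  by (force simp: sumset_0 sumset_Suc)

lemma finite_sumset:
  assumes "A \<subseteq> carrier G" "finite A"
  shows "finite (sumset G n A)"
proof (induction n)
  case (Suc n)
  have "sumset G (Suc n) A = (\<lambda>(x, y). x \<otimes> y) ` (sumset G n A \<times> A)"
    using assms(1) by (auto simp: sumset_Suc)
  with Suc assms(2) show ?case
    by simp
qed (simp add: sumset_0)

lemma sumset_mult:
  assumes A: "A \<subseteq> carrier G" and x: "x \<in> sumset G m A" and y: "y \<in> sumset G n A"
  shows "x \<otimes> y \<in> sumset G (m + n) A"
  using y
proof (induction n arbitrary: y)
  case 0
  then show ?case
    using x subsetD[OF sumset_closed[OF A] x] by (simp add: sumset_0)
next
  case (Suc n)
  then obtain u v where uv: "y = u \<otimes> v" "u \<in> sumset G n A" "v \<in> A"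
    by (auto simp: sumset_Suc[OF A])
  have "x \<in> carrier G" "u \<in> carrier G" "v \<in> carrier G"
    using x uv sumset_closed[OF A] A by auto
  then have "x \<otimes> y = (x \<otimes> u) \<otimes> v"
    using uv(1) by (simp add: m_assoc)
  with Suc.IH[OF uv(2)] uv(3) show ?case
    by (auto simp: sumset_Suc[OF A])
qed

section \<open>Cofinite sumsets\<close>

lemma almost_eq_carrier_iff:
  assumes "A \<subseteq> carrier G"
  shows "sumset G n A \<sim>\<^sub>f carrier G \<longleftrightarrow> finite (carrier G - sumset G n A)"
proof -
  have "sumset G n A - carrier G = {}"
    using sumset_closed[OF assms] by blast
  then have "sym_diff (sumset G n A) (carrier G) = carrier G - sumset G n A"
    by blast
  then show ?thesis
    by (simp only: almost_eq_def)
qed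

lemma infinite_if_almost_eq_carrier:
  assumes "A \<subseteq> carrier G" "sumset G n A \<sim>\<^sub>f carrier G" "infinite (carrier G)"
  shows "infinite A"
  using assms finite_sumset[of A n] by (auto simp: almost_eq_carrier_iff)

text \<open>Translation by \<open>g\<close> is injective, so an infinite translate cannot fit into
  the finite complement of the sumset. A single prescribed element may lie in that complement, hence
  the freedom in \<open>c\<close>.\<close>

lemma sumset_meets_translate:
  assumes A: "A \<subseteq> carrier G" "sumset G n A \<sim>\<^sub>f carrier G"
    and C: "C \<subseteq> carrier G" "infinite C" and g: "g \<in> carrier G"
  obtains c where "c \<in> C" "g \<otimes> c \<in> sumset G n A"
proof (rule ccontr)
  assume "\<not> thesis"
  then have "(\<lambda>c. g \<otimes> c) ` C \<subseteq> carrier G - sumset G n A"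
    using that C(1) g by auto
  then have "finite ((\<lambda>c. g \<otimes> c) ` C)"
    using A by (meson almost_eq_carrier_iff finite_subset)
  moreover have "inj_on (\<lambda>c. g \<otimes> c) C"
    using C(1) g by (intro inj_onI) (metis l_cancel subsetD)
  ultimately show False
    using C(2) finite_imageD by blast
qed

section \<open>The group of differences\<close>

lemma subgroup_difference_group:
  assumes B: "B \<subseteq> carrier G"
  shows "subgroup (difference_group G B) G"
proof (rule subgroupI)
  note closed = subsetD[OF sumset_closed[OF B]]
  show "difference_group G B \<subseteq> carrier G"
    by (auto simp: difference_group_def dest: closed)
  have "\<one> \<otimes> inv \<one> \<in> difference_group G B"
    unfolding difference_group_def using sumset_0 by blast
  then show "difference_group G B \<noteq> {}"
    by blast
  show "inv x \<in> difference_group G B" if x: "x \<in> difference_group G B" for x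
  proof -
    obtain u v m where uv: "x = u \<otimes> inv v" "u \<in> sumset G m B" "v \<in> sumset G m B"
      using x by (auto simp: difference_group_def)
    then have "inv x = v \<otimes> inv u"
      using closed by (simp add: inv_mult m_comm)
    with uv show ?thesis
      by (auto simp: difference_group_def)
  qed
  show "x \<otimes> y \<in> difference_group G B"
    if x: "x \<in> difference_group G B" and y: "y \<in> difference_group G B" for x y
  proof -
    obtain u v m where uv: "x = u \<otimes> inv v" "u \<in> sumset G m B" "v \<in> sumset G m B"
      using x by (auto simp: difference_group_def)
    obtain s t n where st: "y = s \<otimes> inv t" "s \<in> sumset G n B" "t \<in> sumset G n B"
      using y by (auto simp: difference_group_def)
    have "x \<otimes> y = (u \<otimes> s) \<otimes> inv (v \<otimes> t)"
      using uv st closed by (simp add: inv_mult m_ac)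
    moreover have "u \<otimes> s \<in> sumset G (m + n) B" "v \<otimes> t \<in> sumset G (m + n) B"
      using uv st sumset_mult[OF B] by auto
    ultimately show ?thesis
      by (auto simp: difference_group_def)
  qed
qed

lemma difference_in_difference_group:
  assumes "B \<subseteq> carrier G" "x \<in> B" "y \<in> B"
  shows "x \<otimes> inv y \<in> difference_group G B"
  using assms sumset_1[OF assms(1)] unfolding difference_group_def by blast

text \<open>Each of the \<open>n\<close> summands takes one copy of \<open>v\<close> and becomes a
  sum of \<open>l\<close> elements of \<open>B\<close>.\<close>

lemma sumset_shift:
  assumes A: "A \<subseteq> carrier G" and B: "B \<subseteq> carrier G" and v: "v \<in> carrier G"
    and AB: "\<And>x. x \<in> A \<Longrightarrow> x \<otimes> v \<in> sumset G l B"
    and x: "x \<in> sumset G n A"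
  shows "x \<otimes> v [^] n \<in> sumset G (n * l) B"
  using x
proof (induction n arbitrary: x)
  case (Suc n)
  then obtain y z where yz: "x = y \<otimes> z" "y \<in> sumset G n A" "z \<in> A"
    by (auto simp: sumset_Suc[OF A])
  have "y \<in> carrier G" "z \<in> carrier G"
    using yz sumset_closed[OF A] A by auto
  then have "x \<otimes> v [^] Suc n = (z \<otimes> v) \<otimes> (y \<otimes> v [^] n)"
    using v yz(1) by (simp add: m_ac)
  also have "\<dots> \<in> sumset G (l + n * l) B"
    by (intro sumset_mult B AB Suc.IH yz)
  finally show ?case
    by simp
qed (simp add: sumset_0)

lemma exceptional_not_in_difference_group:
  assumes A: "A \<subseteq> carrier G" "sumset G h A \<sim>\<^sub>f carrier G" and "h > 0"
    and a: "a \<in> exceptional_elements G A" and b: "b \<in> A - {a}"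
  shows "a \<otimes> inv b \<notin> difference_group G (A - {a})"
proof
  let ?B = "A - {a}"
  have B: "?B \<subseteq> carrier G"
    using A by blast
  have aA: "a \<in> A" and not_basis: "\<not> is_basis G ?B"
    using a by (auto simp: exceptional_elements_def regular_elements_def)
  assume "a \<otimes> inv b \<in> difference_group G ?B"
  then obtain u v m where uv: "a \<otimes> inv b = u \<otimes> inv v" "u \<in> sumset G m ?B" "v \<in> sumset G m ?B"
    by (auto simp: difference_group_def)
  have c: "a \<in> carrier G" "b \<in> carrier G" "u \<in> carrier G" "v \<in> carrier G"
    using aA b A uv sumset_closed[OF B] by auto
  have "a \<otimes> v = (a \<otimes> inv b) \<otimes> (b \<otimes> v)"
    using c by (metis inv_closed l_inv l_one m_assoc m_closed)
  also have "\<dots> = (u \<otimes> inv v) \<otimes> (v \<otimes> b)"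
    using c uv(1) by (simp add: m_comm)
  also have "\<dots> = b \<otimes> u"
    using c by (metis inv_closed l_inv l_one m_assoc m_closed m_comm)
  finally have av: "a \<otimes> v = b \<otimes> u" .
  \<comment> \<open>Either way one element of \<open>?B\<close> is added to a sum of
    \<open>m\<close> of them: \<open>b\<close> to \<open>u\<close> if \<open>x = a\<close>, and
    \<open>x\<close> to \<open>v\<close> otherwise.\<close>
  have "x \<otimes> v \<in> sumset G (Suc 0 + m) ?B" if "x \<in> A" for x
  proof (cases "x = a")
    case True
    then show ?thesis
      using av b uv(2) sumset_mult[OF B, of b "Suc 0"] sumset_1[OF B] by simp
  next
    case False
    then show ?thesis
      using that uv(3) sumset_mult[OF B, of x "Suc 0"] sumset_1[OF B] by simp
  qed
  then have shift: "x \<otimes> v [^] h \<in> sumset G (h * Suc m) ?B" if "x \<in> sumset G h A" for x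
    using sumset_shift[OF A(1) B c(4), of "Suc m"] that by simp
  \<comment> \<open>Whatever the new sumset misses is a translate of one of the finitely many
    elements that \<open>sumset G h A\<close> misses.\<close>
  have "carrier G - sumset G (h * Suc m) ?B \<subseteq> (\<lambda>x. x \<otimes> v [^] h) ` (carrier G - sumset G h A)"
  proof
    fix y assume y: "y \<in> carrier G - sumset G (h * Suc m) ?B"
    let ?x = "y \<otimes> inv (v [^] h)"
    have "y = ?x \<otimes> v [^] h"
      using y c by (simp add: m_assoc)
    moreover have "?x \<in> carrier G"
      using y c by simp
    ultimately show "y \<in> (\<lambda>x. x \<otimes> v [^] h) ` (carrier G - sumset G h A)"
      using shift y by (metis DiffD2 DiffI image_eqI)
  qed
  then have "finite (carrier G - sumset G (h * Suc m) ?B)"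
    using A by (meson almost_eq_carrier_iff finite_imageI finite_subset)
  then have "sumset G (h * Suc m) ?B \<sim>\<^sub>f carrier G"
    by (simp add: almost_eq_carrier_iff[OF B])
  moreover have "h * Suc m > 0"
    using \<open>h > 0\<close> by simp
  ultimately show False
    using not_basis B unfolding is_basis_def by blast
qed

section \<open>The upper bound\<close>

text \<open>Modulo \<open>H\<close> every \<open>f j\<close> equals \<open>b\<close>, so the sum
  reduces to \<open>card S\<close> copies of \<open>b\<close>.\<close>

lemma finprod_in_coset:
  assumes H: "subgroup H G" and b: "b \<in> carrier G" and "finite S"
    and f: "\<And>j. j \<in> S \<Longrightarrow> f j \<in> carrier G" "\<And>j. j \<in> S \<Longrightarrow> f j \<otimes> inv b \<in> H"
  shows "\<exists>k\<in>H. finprod G f S = b [^] card S \<otimes> k"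
  using \<open>finite S\<close> f
proof (induction S)
  case empty
  then show ?case
    using subgroup.one_closed[OF H] by force
next
  case (insert j S)
  then obtain k where k: "k \<in> H" "finprod G f S = b [^] card S \<otimes> k"
    by auto
  have c: "f j \<in> carrier G" "k \<in> carrier G" "f \<in> S \<rightarrow> carrier G"
    using insert k subgroup.subset[OF H] by auto
  have "finprod G f (insert j S) = f j \<otimes> (b [^] card S \<otimes> k)"
    using insert c k by simp
  also have "f j = (f j \<otimes> inv b) \<otimes> b"
    using b c by (simp add: m_assoc)
  also have "\<dots> \<otimes> (b [^] card S \<otimes> k) = b [^] card (insert j S) \<otimes> ((f j \<otimes> inv b) \<otimes> k)"
    using b c insert(1,2) by (simp add: m_ac)
  finally show ?case
    using insert.prems k subgroup.m_closed[OF H] by blast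
qed

text \<open>Modulo \<open>H\<close>, \<open>c\<close> and all elements of \<open>T\<close> except
  \<open>a\<close> reduce to \<open>b\<close>, so equality would force \<open>a - b\<close> into
  \<open>H\<close>. This separates the target element of the main argument from all sums that avoid
  \<open>a\<close>.\<close>

lemma not_in_coset_product:
  assumes H: "subgroup H G" and b: "b \<in> carrier G" and c: "c \<in> carrier G" "c \<otimes> inv b \<in> H"
    and T: "finite T" "T \<subseteq> carrier G" "a \<in> T" "a \<otimes> inv b \<notin> H"
    and TH: "\<And>t. t \<in> T - {a} \<Longrightarrow> t \<otimes> inv b \<in> H"
    and k: "k \<in> H"
  shows "finprod G (\<lambda>t. t) T \<otimes> inv b \<otimes> c \<noteq> b [^] card T \<otimes> k"
proof
  assume eq: "finprod G (\<lambda>t. t) T \<otimes> inv b \<otimes> c = b [^] card T \<otimes> k"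
  obtain l where l: "l \<in> H" "finprod G (\<lambda>t. t) (T - {a}) = b [^] card (T - {a}) \<otimes> l"
    using finprod_in_coset[OF H b, of "T - {a}" "\<lambda>t. t"] T TH by blast
  define n where "n = card (T - {a})"
  have cardT: "card T = Suc n"
    using card.remove[OF T(1,3)] by (simp add: n_def)
  note Hc = subsetD[OF subgroup.subset[OF H]]
  have aG: "a \<in> carrier G" "k \<in> carrier G" "l \<in> carrier G"
    using T l k Hc by auto
  have "finprod G (\<lambda>t. t) T = a \<otimes> (b [^] n \<otimes> l)"
    using finprod_insert[of "T - {a}" a "\<lambda>t. t"] T l by (auto simp: insert_absorb n_def)
  with eq have eq': "a \<otimes> (b [^] n \<otimes> l) \<otimes> inv b \<otimes> c = b [^] n \<otimes> b \<otimes> k"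
    by (simp add: cardT)
  \<comment> \<open>With \<open>d\<close> opaque, \<open>m_ac\<close> moves \<open>a - b\<close>
    around as a single factor, and the multiples of \<open>b\<close> can be cancelled.\<close>
  define d where "d = a \<otimes> inv b"
  have d: "d \<in> carrier G" "d \<otimes> b = a"
    using aG b by (simp_all add: d_def m_assoc)
  have "b [^] n \<otimes> (b \<otimes> (d \<otimes> (l \<otimes> (c \<otimes> inv b)))) = (d \<otimes> b) \<otimes> (b [^] n \<otimes> l) \<otimes> inv b \<otimes> c"
    using b c aG d(1) by (simp add: m_ac)
  also have "\<dots> = b [^] n \<otimes> (b \<otimes> k)"
    using eq' b aG by (simp add: d(2) m_assoc)
  finally have "b [^] n \<otimes> (b \<otimes> ((a \<otimes> inv b) \<otimes> (l \<otimes> (c \<otimes> inv b)))) = b [^] n \<otimes> (b \<otimes> k)"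
    by (simp only: d_def)
  then have "(a \<otimes> inv b) \<otimes> (l \<otimes> (c \<otimes> inv b)) = k"
    using b c aG by simp
  then have "a \<otimes> inv b = k \<otimes> inv (l \<otimes> (c \<otimes> inv b))"
    using b c aG inv_solve_right[of "a \<otimes> inv b" k "l \<otimes> (c \<otimes> inv b)"] by simp
  also have "\<dots> \<in> H"
    using k l c H by (meson subgroup.m_closed subgroup.m_inv_closed)
  finally show False
    using T by blast
qed

text \<open>Size exactly \<open>h\<close> matches the number of summands: a sum of \<open>h\<close>
  elements that uses all of \<open>T\<close> uses each of them once. Larger or infinite sets contain
  such a \<open>T\<close>.\<close>

lemma no_exceptional_set_of_card:
  assumes inf: "infinite (carrier G)" and "h > 0"
    and A: "A \<subseteq> carrier G" "sumset G h A \<sim>\<^sub>f carrier G"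
    and T: "T \<subseteq> exceptional_elements G A" "finite T"
  shows "card T \<noteq> h"
proof
  assume card: "card T = h"
  have TA: "T \<subseteq> A"
    using T by (auto simp: exceptional_elements_def)
  have infAT: "infinite (A - T)"
    using infinite_if_almost_eq_carrier[OF A inf] T by simp
  then obtain b where b: "b \<in> A - T"
    using infinite_imp_nonempty by blast
  define P where "P = finprod G (\<lambda>t. t) T"
  have PG: "P \<in> carrier G" and bG: "b \<in> carrier G"
    using TA A b by (auto simp: P_def intro!: finprod_closed)
  \<comment> \<open>Leaving out \<open>b\<close> makes the perturbation \<open>c - b\<close>
    nonzero, which the end of the proof contradicts.\<close>
  have "infinite (A - T - {b})"
    using infAT by simp
  then obtain c where c: "c \<in> A - T - {b}" "P \<otimes> inv b \<otimes> c \<in> sumset G h A"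
    using sumset_meets_translate[OF A, of "A - T - {b}" "P \<otimes> inv b"] A PG bG by auto
  have cG: "c \<in> carrier G"
    using c A by blast
  obtain f where f: "P \<otimes> inv b \<otimes> c = finprod G f {..<h}" "f \<in> {..<h} \<rightarrow> A"
    using c(2) by (auto simp: sumset_def)
  have "T \<subseteq> f ` {..<h}"
  proof (rule ccontr)
    assume "\<not> T \<subseteq> f ` {..<h}"
    then obtain a where a: "a \<in> T" "a \<notin> f ` {..<h}"
      by blast
    let ?H = "difference_group G (A - {a})"
    have B: "A - {a} \<subseteq> carrier G"
      using A by blast
    have H: "subgroup ?H G"
      by (rule subgroup_difference_group[OF B])
    have bB: "b \<in> A - {a}"
      using a b by blast
    \<comment> \<open>All summands avoid \<open>a\<close>, so each lies in the coset of
      \<open>b\<close>.\<close>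
    have "\<exists>k\<in>?H. finprod G f {..<h} = b [^] card {..<h} \<otimes> k"
    proof (rule finprod_in_coset[OF H bG])
      show "f j \<in> carrier G" "f j \<otimes> inv b \<in> ?H" if "j \<in> {..<h}" for j
        using that f(2) a(2) A difference_in_difference_group[OF B _ bB, of "f j"] by blast+
    qed simp
    then obtain k where "k \<in> ?H" "P \<otimes> inv b \<otimes> c = b [^] card T \<otimes> k"
      by (auto simp: f(1) card)
    moreover have "P \<otimes> inv b \<otimes> c \<noteq> b [^] card T \<otimes> k"
      unfolding P_def
    proof (rule not_in_coset_product[OF H bG cG _ T(2) _ a(1)])
      show "c \<otimes> inv b \<in> ?H" "\<And>t. t \<in> T - {a} \<Longrightarrow> t \<otimes> inv b \<in> ?H"
        using c a TA difference_in_difference_group[OF B _ bB] by blast+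
      show "a \<otimes> inv b \<notin> ?H"
        using exceptional_not_in_difference_group[OF A \<open>h > 0\<close> _ bB] a T by blast
    qed (use TA A \<open>k \<in> ?H\<close> in auto)
    ultimately show False
      by blast
  qed
  \<comment> \<open>The \<open>h\<close> indices cover the \<open>h\<close> elements of
    \<open>T\<close>, so \<open>f\<close> is a bijection onto \<open>T\<close> and its values add up
    to \<open>P\<close>.\<close>
  then have fT: "f ` {..<h} = T"
    by (intro card_subset_eq[symmetric])
      (use card card_image_le[of "{..<h}" f] card_mono[of "f ` {..<h}" T] in auto)
  then have "inj_on f {..<h}"
    by (simp add: card eq_card_imp_inj_on)
  moreover have "(\<lambda>t. t) \<in> f ` {..<h} \<rightarrow> carrier G"
    using fT TA A by auto
  ultimately have "finprod G f {..<h} = P"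
    using finprod_reindex[of "\<lambda>t. t" f "{..<h}"] by (simp add: P_def fT)
  then have "P \<otimes> (inv b \<otimes> c) = P \<otimes> \<one>"
    using f(1) PG bG cG by (simp add: m_assoc)
  then have "inv b \<otimes> c = \<one>"
    using PG bG cG by (metis inv_closed l_cancel m_closed one_closed)
  then have "c = b"
    using bG cG by (metis inv_closed inv_equality inv_inv m_comm)
  with c show False
    by blast
qed

lemma card_exceptional_le:
  assumes "infinite (carrier G)" "h > 0" "A \<subseteq> carrier G" "sumset G h A \<sim>\<^sub>f carrier G"
  shows "finite (exceptional_elements G A) \<and> card (exceptional_elements G A) \<le> h - 1"
proof (rule ccontr)
  let ?X = "exceptional_elements G A"
  assume "\<not> (finite ?X \<and> card ?X \<le> h - 1)"
  then have "infinite ?X \<or> (finite ?X \<and> h \<le> card ?X)"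
    by linarith
  then obtain T where "T \<subseteq> ?X" "finite T" "card T = h"
    by (metis infinite_arbitrarily_large obtain_subset_with_card_n)
  with no_exceptional_set_of_card[OF assms] show False
    by blast
qed

text \<open>Finiteness in the premise excludes the infinite value of \<open>ecard\<close>.\<close>

lemma E_le:
  assumes "\<And>A. A \<subseteq> carrier G \<Longrightarrow> sumset G h A \<sim>\<^sub>f carrier G \<Longrightarrow>
    finite (exceptional_elements G A) \<and> card (exceptional_elements G A) \<le> m"
  shows "E G h \<le> enat m"
  unfolding E_def by (rule Sup_least) (use assms in \<open>auto simp: ecard_def\<close>)

section \<open>Groups without exceptional elements\<close>

text \<open>Here \<open>j\<close> counts the summands equal to \<open>a\<close>; every other summand
  reduces to \<open>b\<close> modulo \<open>H\<close>. So a sum of \<open>n\<close> elements meets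
  at most \<open>n + 1\<close> cosets.\<close>

lemma sumset_in_cosets:
  assumes H: "subgroup H G" and A: "A \<subseteq> carrier G" "a \<in> carrier G" "b \<in> carrier G"
    and AH: "\<And>y. y \<in> A - {a} \<Longrightarrow> y \<otimes> inv b \<in> H"
    and x: "x \<in> sumset G n A"
  shows "\<exists>j\<le>n. \<exists>k\<in>H. x = b [^] n \<otimes> ((a \<otimes> inv b) [^] j \<otimes> k)"
  using x
proof (induction n arbitrary: x)
  case 0
  then show ?case
    using subgroup.one_closed[OF H] by (auto simp: sumset_0 intro!: bexI[of _ \<one>])
next
  case (Suc n)
  then obtain y z where yz: "x = y \<otimes> z" "y \<in> sumset G n A" "z \<in> A"
    by (auto simp: sumset_Suc[OF A(1)])
  obtain j k where j: "j \<le> n" "k \<in> H" "y = b [^] n \<otimes> ((a \<otimes> inv b) [^] j \<otimes> k)"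
    using Suc.IH[OF yz(2)] by auto
  have c: "z \<in> carrier G" "k \<in> carrier G"
    using yz A j subgroup.subset[OF H] by auto
  have "z = b \<otimes> (z \<otimes> inv b)"
    using c A by (metis inv_closed l_inv m_assoc m_comm r_one)
  then have "x = b [^] n \<otimes> ((a \<otimes> inv b) [^] j \<otimes> k) \<otimes> (b \<otimes> (z \<otimes> inv b))"
    using yz(1) j(3) by simp
  also have "\<dots> = b [^] Suc n \<otimes> ((a \<otimes> inv b) [^] j \<otimes> (k \<otimes> (z \<otimes> inv b)))"
    using c A by (simp add: m_ac)
  finally have x: "x = b [^] Suc n \<otimes> ((a \<otimes> inv b) [^] j \<otimes> (k \<otimes> (z \<otimes> inv b)))" .
  show ?case
  proof (cases "z = a")
    case True
    then have "x = b [^] Suc n \<otimes> ((a \<otimes> inv b) [^] Suc j \<otimes> k)"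
      using x c A by (simp add: m_ac)
    with j show ?thesis
      by (metis Suc_le_mono)
  next
    case False
    then have "k \<otimes> (z \<otimes> inv b) \<in> H"
      using AH yz(3) j(2) subgroup.m_closed[OF H] by blast
    with x j show ?thesis
      by (metis le_SucI)
  qed
qed

text \<open>Modulo \<open>?H\<close>, sums of \<open>h\<close> elements have the form
  \<open>h b + j d\<close> with \<open>j \<le> h\<close>. Reaching \<open>h b + (h + 1) d\<close> as
  well bounds the order of \<open>d\<close> modulo \<open>?H\<close> by \<open>h + 1\<close>, so
  that \<open>(h + 1)!\<close> kills \<open>d\<close> there. By \<open>exponent\<close>,
  \<open>(h + 1)! + 1\<close> kills it too, and \<open>d\<close> would lie in
  \<open>?H\<close>.\<close>

lemma exceptional_elements_empty:
  assumes inf: "infinite (carrier G)" and "h > 0"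
    and A: "A \<subseteq> carrier G" "sumset G h A \<sim>\<^sub>f carrier G"
    and exponent: "\<And>x. x \<in> carrier G \<Longrightarrow> x [^] Suc (fact (Suc h)) = \<one>"
  shows "exceptional_elements G A = {}"
proof (rule ccontr)
  assume "exceptional_elements G A \<noteq> {}"
  then obtain a where a: "a \<in> exceptional_elements G A"
    by blast
  let ?B = "A - {a}" and ?H = "difference_group G (A - {a})"
  have B: "?B \<subseteq> carrier G"
    using A by blast
  have H: "subgroup ?H G"
    by (rule subgroup_difference_group[OF B])
  have infB: "infinite ?B"
    using infinite_if_almost_eq_carrier[OF A inf] by simp
  then obtain b where b: "b \<in> ?B"
    using infinite_imp_nonempty by blast
  have aG: "a \<in> carrier G" and bG: "b \<in> carrier G"
    using a b A by (auto simp: exceptional_elements_def)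
  define d where "d = a \<otimes> inv b"
  have dG: "d \<in> carrier G"
    using aG bG by (simp add: d_def)
  have dH: "d \<notin> ?H"
    unfolding d_def by (rule exceptional_not_in_difference_group[OF A \<open>h > 0\<close> a b])
  \<comment> \<open>The multiple \<open>Suc h\<close> of \<open>d\<close> is the first one outside
    the range of \<open>j\<close>; the correction \<open>c - b\<close> lies in \<open>?H\<close> and
    avoids the finitely many missed elements.\<close>
  obtain c where c: "c \<in> ?B" "b [^] h \<otimes> d [^] Suc h \<otimes> inv b \<otimes> c \<in> sumset G h A"
    using sumset_meets_translate[OF A B infB, of "b [^] h \<otimes> d [^] Suc h \<otimes> inv b"] bG dG by auto
  have cG: "c \<in> carrier G" and cH: "c \<otimes> inv b \<in> ?H"
    using c B difference_in_difference_group[OF B c(1) b] by auto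
  obtain j k where j: "j \<le> h" "k \<in> ?H"
      "b [^] h \<otimes> d [^] Suc h \<otimes> inv b \<otimes> c = b [^] h \<otimes> (d [^] j \<otimes> k)"
    using sumset_in_cosets[OF H A(1) aG bG difference_in_difference_group[OF B _ b] c(2)]
    unfolding d_def by blast
  have kG: "k \<in> carrier G"
    using j(2) subgroup.subset[OF H] by blast
  define m where "m = Suc h - j"
  have m: "0 < m" "m \<le> Suc h" "Suc h = j + m"
    using j(1) by (auto simp: m_def)
  have "d [^] Suc h = d [^] j \<otimes> d [^] m"
    unfolding m(3) using dG by (simp add: nat_pow_mult)
  then have "b [^] h \<otimes> (d [^] j \<otimes> (d [^] m \<otimes> (c \<otimes> inv b))) = b [^] h \<otimes> d [^] Suc h \<otimes> inv b \<otimes> c"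
    using bG cG dG by (simp add: m_ac del: nat_pow_Suc)
  also note j(3)
  finally have "d [^] m \<otimes> (c \<otimes> inv b) = k"
    using bG cG dG kG by simp
  then have "d [^] m = k \<otimes> inv (c \<otimes> inv b)"
    using bG cG dG kG inv_solve_right[of "d [^] m" k "c \<otimes> inv b"] by simp
  also have "\<dots> \<in> ?H"
    using j(2) cH H by (meson subgroup.m_closed subgroup.m_inv_closed)
  finally have dm: "d [^] m \<in> ?H" .
  obtain q where q: "fact (Suc h) = m * q"
    using dvd_fact[of m "Suc h"] m by (auto elim: dvdE)
  have pow_in_H: "y [^] n \<in> ?H" if "y \<in> ?H" for y and n :: nat
    by (induction n) (use that H in \<open>auto intro: subgroup.one_closed subgroup.m_closed\<close>)
  have "d [^] (fact (Suc h) :: nat) = (d [^] m) [^] q"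
    unfolding q using dG by (simp add: nat_pow_pow)
  with dm have dfact: "d [^] (fact (Suc h) :: nat) \<in> ?H"
    using pow_in_H by simp
  \<comment> \<open>Deleting \<open>fact_Suc\<close> keeps the factorial in one piece, so that the
    exponent splits off a single \<open>d\<close>.\<close>
  have "d [^] (fact (Suc h) :: nat) \<otimes> d = \<one>"
    using exponent[OF dG] by (simp del: fact_Suc)
  then have "d = inv (d [^] (fact (Suc h) :: nat))"
    using dG by (metis inv_closed inv_equality inv_inv nat_pow_closed)
  with dfact dH show False
    using subgroup.m_inv_closed[OF H] by metis
qed

end

section \<open>Infinite powers of finite cyclic groups\<close>

text \<open>The full product, indexed by all of \<open>nat\<close>, so that extensionality is
  vacuous and elements are plain functions.\<close>

definition mod_power :: "nat \<Rightarrow> (nat \<Rightarrow> int) monoid" where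
  "mod_power q = product_group UNIV (\<lambda>_. integer_mod_group q)"

lemma carrier_mod_power: "q > 0 \<Longrightarrow> carrier (mod_power q) = {f. \<forall>n. f n \<in> {0..<int q}}"
  by (auto simp: mod_power_def carrier_integer_mod_group PiE_def Pi_def)

lemma mult_mod_power: "(f \<otimes>\<^bsub>mod_power q\<^esub> g) n = (f n + g n) mod int q"
  by (simp add: mod_power_def)

lemma one_mod_power: "\<one>\<^bsub>mod_power q\<^esub> n = 0"
  by (simp add: mod_power_def)

lemma comm_group_mod_power: "comm_group (mod_power q)"
  by (rule group.group_comm_groupI) (auto simp: mod_power_def add.commute)

lemma infinite_mod_power_coset:
  assumes "q \<ge> 2" "v \<in> {0..<int q}"
  shows "infinite {f \<in> carrier (mod_power q). f i = v}"
proof -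
  \<comment> \<open>Besides the prescribed value at \<open>i\<close>, a single \<open>1\<close> is
    placed at a varying coordinate \<open>m\<close>; \<open>1\<close> is a nonzero residue since
    \<open>q \<ge> 2\<close>.\<close>
  let ?F = "\<lambda>m n. if n = i then v else if n = m then 1 else (0::int)"
  have "inj_on ?F (UNIV - {i})"
    by (rule inj_onI) (metis DiffE insertI1 zero_neq_one)
  then have "infinite (?F ` (UNIV - {i}))"
    by (simp add: finite_image_iff infinite_UNIV_nat)
  moreover have "?F ` (UNIV - {i}) \<subseteq> {f \<in> carrier (mod_power q). f i = v}"
    using assms by (auto simp: carrier_mod_power)
  ultimately show ?thesis
    by (meson finite_subset)
qed

lemma infinite_mod_power: "q \<ge> 2 \<Longrightarrow> infinite (carrier (mod_power q))"
  using infinite_mod_power_coset[of q 0 0] by (auto elim: contrapos_nn)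

lemma pow_mod_power:
  assumes "q > 0" "f \<in> carrier (mod_power q)"
  shows "(f [^]\<^bsub>mod_power q\<^esub> (m::nat)) n = (int m * f n) mod int q"
  by (induction m)
    (auto simp: one_mod_power mult_mod_power mod_simps algebra_simps)

lemma pow_mod_power_exponent:
  assumes "q > 0" "f \<in> carrier (mod_power q)"
  shows "f [^]\<^bsub>mod_power q\<^esub> q = \<one>\<^bsub>mod_power q\<^esub>"
  by (rule ext) (simp add: pow_mod_power[OF assms] one_mod_power)

lemma finprod_mod_power:
  assumes q: "q > 0" and "finite S" and "f \<in> S \<rightarrow> carrier (mod_power q)"
  shows "finprod (mod_power q) f S n = (\<Sum>j\<in>S. f j n) mod int q"
proof -
  interpret comm_group "mod_power q"
    by (rule comm_group_mod_power)
  show ?thesis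
    using assms(2,3)
    by (induction S) (auto simp: one_mod_power mult_mod_power mod_simps)
qed

lemma E_mod_power_eq_0:
  assumes "h > 0"
  shows "E (mod_power (Suc (fact (Suc h)))) h = 0"
proof -
  let ?G = "mod_power (Suc (fact (Suc h)))"
  interpret comm_group ?G
    by (rule comm_group_mod_power)
  have inf: "infinite (carrier ?G)"
    by (rule infinite_mod_power) (use fact_ge_1[of "Suc h", where 'a = nat] in linarith)
  have "exceptional_elements ?G A = {}"
    if "A \<subseteq> carrier ?G" "sumset ?G h A \<sim>\<^sub>f carrier ?G" for A
    using exceptional_elements_empty[OF inf assms that] pow_mod_power_exponent by blast
  then have "E ?G h \<le> enat 0"
    by (intro E_le) simp
  then show ?thesis
    by (metis le_zero_eq zero_enat_def)
qed

section \<open>A basis of order \<open>h\<close> with \<open>h - 1\<close> exceptional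
  elements\<close>

definition unit_vec :: "nat \<Rightarrow> nat \<Rightarrow> int" where
  "unit_vec i n = (if n = i then 1 else 0)"

definition coordinate_basis :: "nat \<Rightarrow> (nat \<Rightarrow> int) set" where
  "coordinate_basis r = {f \<in> carrier (mod_power 2). \<forall>i<r. f i = 0} \<union> unit_vec ` {..<r}"

lemma coordinate_basis_carrier: "coordinate_basis r \<subseteq> carrier (mod_power 2)"
  by (auto simp: coordinate_basis_def carrier_mod_power unit_vec_def)

lemma sumset_coordinate_basis:
  "sumset (mod_power 2) (Suc r) (coordinate_basis r) = carrier (mod_power 2)"
proof
  interpret comm_group "mod_power 2"
    by (rule comm_group_mod_power)
  show "sumset (mod_power 2) (Suc r) (coordinate_basis r) \<subseteq> carrier (mod_power 2)"
    by (rule sumset_closed[OF coordinate_basis_carrier])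
  show "carrier (mod_power 2) \<subseteq> sumset (mod_power 2) (Suc r) (coordinate_basis r)"
  proof
    fix g assume g: "g \<in> carrier (mod_power 2)"
    \<comment> \<open>Summand \<open>j < r\<close> carries coordinate \<open>j\<close> alone, and
      summand \<open>r\<close> carries all coordinates from \<open>r\<close> on.\<close>
    define f where "f j = (\<lambda>n. if j < r then (if n = j then g n else 0) else if n < r then 0 else g n)" for j
    have g01: "g n = 0 \<or> g n = 1" for n
      using g by (force simp: carrier_mod_power)
    have fA: "f j \<in> coordinate_basis r" for j
    \<comment> \<open>Outside this case the first \<open>r\<close> coordinates of \<open>f j\<close>
      vanish; in particular zero is available as padding to exactly \<open>r + 1\<close>
      summands.\<close>
    proof (cases "j < r \<and> g j = 1")
      case True
      then have "f j = unit_vec j"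
        by (auto simp: f_def unit_vec_def)
      with True show ?thesis
        by (auto simp: coordinate_basis_def)
    next
      case False
      then have "f j \<in> {f \<in> carrier (mod_power 2). \<forall>i<r. f i = 0}"
        using g g01[of j] by (auto simp: f_def carrier_mod_power)
      then show ?thesis
        by (simp add: coordinate_basis_def)
    qed
    have "finprod (mod_power 2) f {..<Suc r} n = g n" for n
    proof -
      have "(\<Sum>j<r. f j n) = (\<Sum>j<r. if n = j then g n else 0)"
        by (rule sum.cong) (auto simp: f_def)
      also have "\<dots> = (if n < r then g n else 0)"
        by simp
      finally have "(\<Sum>j<Suc r. f j n) = g n"
        by (simp add: f_def)
      moreover have "f \<in> {..<Suc r} \<rightarrow> carrier (mod_power 2)"
        using fA coordinate_basis_carrier by blast
      ultimately show ?thesis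
        using g01[of n] by (auto simp: finprod_mod_power simp del: sum.lessThan_Suc)
    qed
    then have "g = finprod (mod_power 2) f {..<Suc r}"
      by auto
    with fA show "g \<in> sumset (mod_power 2) (Suc r) (coordinate_basis r)"
      by (auto simp: sumset_def)
  qed
qed

text \<open>Only \<open>unit_vec i\<close> has a nonzero coordinate \<open>i\<close>. Without it
  every sum vanishes there, and the infinitely many elements with coordinate \<open>1\<close> are
  missed.\<close>

lemma unit_vec_exceptional:
  assumes "i < r"
  shows "unit_vec i \<in> exceptional_elements (mod_power 2) (coordinate_basis r)"
proof -
  interpret comm_group "mod_power 2"
    by (rule comm_group_mod_power)
  let ?B = "coordinate_basis r - {unit_vec i}"
  have B: "?B \<subseteq> carrier (mod_power 2)"
    using coordinate_basis_carrier by blast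
  have B_zero: "f i = 0" if "f \<in> ?B" for f
    using that assms by (auto simp: coordinate_basis_def unit_vec_def)
  have "f i = 0" if "f \<in> sumset (mod_power 2) k ?B" for f k
    using that
  proof (induction k arbitrary: f)
    case (Suc k)
    then obtain x y where "f = x \<otimes>\<^bsub>mod_power 2\<^esub> y" "x \<in> sumset (mod_power 2) k ?B" "y \<in> ?B"
      by (auto simp: sumset_Suc[OF B])
    then show ?case
      by (simp add: Suc.IH B_zero mult_mod_power)
  qed (simp add: sumset_0 one_mod_power)
  then have "{f \<in> carrier (mod_power 2). f i = 1} \<subseteq> carrier (mod_power 2) - sumset (mod_power 2) k ?B" for k
    by force
  then have "\<not> sumset (mod_power 2) k ?B \<sim>\<^sub>f carrier (mod_power 2)" for k
    using infinite_mod_power_coset[of 2 1 i] by (auto simp: almost_eq_carrier_iff[OF B] dest: finite_subset)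
  then show ?thesis
    using assms
    by (auto simp: exceptional_elements_def regular_elements_def is_basis_def coordinate_basis_def)
qed

lemma E_mod_power_2:
  assumes "h > 0"
  shows "E (mod_power 2) h = enat (h - 1)"
proof (rule antisym)
  interpret comm_group "mod_power 2"
    by (rule comm_group_mod_power)
  note bound = card_exceptional_le[OF infinite_mod_power[OF order_refl] assms]
  show "E (mod_power 2) h \<le> enat (h - 1)"
    by (rule E_le) (rule bound)
  \<comment> \<open>With \<open>h - 1\<close> unit vectors the order is \<open>(h - 1) + 1\<close>,
    which is \<open>h\<close> because \<open>h > 0\<close>.\<close>
  let ?A = "coordinate_basis (h - 1)"
  let ?X = "exceptional_elements (mod_power 2) ?A"
  have sum: "sumset (mod_power 2) h ?A \<sim>\<^sub>f carrier (mod_power 2)"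
    using sumset_coordinate_basis[of "h - 1"] assms by (simp add: almost_eq_def)
  have fin: "finite ?X"
    using bound[OF coordinate_basis_carrier sum] by blast
  have "inj unit_vec"
    by (rule injI) (metis unit_vec_def zero_neq_one)
  then have "h - 1 = card (unit_vec ` {..<h - 1})"
    by (simp add: card_image inj_on_subset)
  also have "\<dots> \<le> card ?X"
    by (rule card_mono[OF fin]) (use unit_vec_exceptional in blast)
  finally have "enat (h - 1) \<le> ecard ?X"
    using fin by (simp add: ecard_def)
  also have "\<dots> \<le> E (mod_power 2) h"
    unfolding E_def by (rule Sup_upper) (use sum coordinate_basis_carrier in blast)
  finally show "enat (h - 1) \<le> E (mod_power 2) h" .
qed

theorem theorem1p2:
  shows "(\<forall>(G :: 'a monoid) (h :: nat).
            comm_group G \<and> infinite (carrier G) \<and> h \<ge> 2 \<longrightarrow>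
              E G h \<le> enat (h - 1) \<and>
              (\<forall>A. A \<subseteq> carrier G \<and> sumset G h A \<sim>\<^sub>f carrier G \<longrightarrow>
                 finite (exceptional_elements G A) \<and> card (exceptional_elements G A) \<le> h - 1))
       \<and> (\<exists>G :: (nat \<Rightarrow> int) monoid.
            comm_group G \<and> infinite (carrier G) \<and>
            (\<forall>h::nat. h \<ge> 2 \<longrightarrow> E G h = enat (h - 1)))
       \<and> (\<forall>h::nat. h \<ge> 2 \<longrightarrow>
            (\<exists>G :: (nat \<Rightarrow> int) monoid.
               comm_group G \<and> infinite (carrier G) \<and> E G h = 0))"
proof (intro conjI allI impI)
  fix G :: "'a monoid" and h :: nat
  assume "comm_group G \<and> infinite (carrier G) \<and> h \<ge> 2"
  then have G: "comm_group G" "infinite (carrier G)" "h > 0"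
    by auto
  note bound = comm_group.card_exceptional_le[OF G]
  show "E G h \<le> enat (h - 1)"
    by (rule comm_group.E_le[OF G(1)]) (rule bound)
  fix A assume "A \<subseteq> carrier G \<and> sumset G h A \<sim>\<^sub>f carrier G"
  then show "finite (exceptional_elements G A)" "card (exceptional_elements G A) \<le> h - 1"
    using bound by blast+
next
  \<comment> \<open>The one group \<open>mod_power 2\<close> serves all \<open>h\<close>, whereas
    the modulus in the last part grows with \<open>h\<close>.\<close>
  show "\<exists>G :: (nat \<Rightarrow> int) monoid. comm_group G \<and> infinite (carrier G) \<and>
      (\<forall>h::nat. h \<ge> 2 \<longrightarrow> E G h = enat (h - 1))"
    using comm_group_mod_power infinite_mod_power E_mod_power_2
    by (metis less_le_trans order_refl pos2)
next
  fix h :: nat assume "h \<ge> 2"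
  moreover have "Suc (fact (Suc h)) \<ge> 2"
    using fact_ge_1[of "Suc h", where 'a = nat] by linarith
  ultimately show "\<exists>G :: (nat \<Rightarrow> int) monoid. comm_group G \<and> infinite (carrier G) \<and> E G h = 0"
    using comm_group_mod_power infinite_mod_power E_mod_power_eq_0
    by (metis less_le_trans pos2)
qed

end
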